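(* Let $\psi,\nu\in\Psi$. For $\delta\in(0,1)$ and $p\ge2$ put $$R(\delta,p,\psi)=\inf\Bigl\{\delta^{2/(p\beta+2)}\,\bigl[\psi(\alpha p)\bigr]^{p\beta/(p\beta+2)}:\ \alpha,\beta>1,\ \tfrac1\alpha+\tfrac1\beta=1\Bigr\}.$$ Suppose that $$\lim_{\delta\to0+}\ \sup_{p\ge2}\frac{R(\delta,p,\psi)}{\nu(p)}=0.$$ Then for every centered martingale $(S_n,F_n)$ such that $\sup_n\|S_n\|G(\psi)<\infty$, one has $$\lim_{n\to\infty}\|S_n-S\|G(\nu)=0,$$ where $S=\lim_{n\to\infty}S_n$ almost everywhere.
   Context: $(\Omega,F,\mathbf P)$ is an arbitrary probability space with expectation $\mathbf E$ and $|\eta|_p=(\mathbf E|\eta|^p)^{1/p}$. A centered martingale $(S_n,F_n)$ is a martingale with respect to a filtration $\{\emptyset,\Omega\}=F_0\subset F_1\subset F_2\subset\dots\subset F$ with $\mathbf E S_n=0$ and $\mathbf E|S_n|<\infty$ for all $n$. $\Psi$ is the set of all functions $\psi(p)=\exp(W^*(p)/p)$, $p\ge2$, where $W^*(p)=\sup_{z\ge2}(pz-W(z))$ and $W:[2,\infty)\to\mathbb R$ is continuous, strictly increasing, convex, with left derivative $W'_-(u)\to\infty$ as $u\to\infty$. $G(\psi)$ is the space of measurable $\eta:\Omega\to\mathbb R$ with $\|\eta\|G(\psi)=\sup_{p\ge2}|\eta|_p/\psi(p)<\infty$. The almost everywhere limit $S$ exists by Doob's theorem, since $\sup_n|S_n|_2<\infty$.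 *)

theory Defs
  imports "HOL-Probability.Probability"
begin

text \<open>
  Functions on \<open>[2, \<infinity>)\<close> are rendered as functions on \<open>real\<close> of which only the values on
  \<open>{2..}\<close> are ever used.
\<close>

definition admissible_W :: "(real \<Rightarrow> real) \<Rightarrow> bool" where
  "admissible_W W \<longleftrightarrow>
     continuous_on {2..} W \<and> strict_mono_on {2..} W \<and> convex_on {2..} W \<and>
     (\<exists>D. (\<forall>u>2. (W has_real_derivative D u) (at_left u)) \<and> filterlim D at_top at_top)"

definition W_conj :: "(real \<Rightarrow> real) \<Rightarrow> real \<Rightarrow> real" where
  "W_conj W p = (SUP z\<in>{2..}. p * z - W z)"

text \<open>The supremum above is a genuine one, not the arbitrary value of an unbounded \<open>Sup\<close> on the reals:\<close>

lemma W_conj_bdd_above: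
  assumes "admissible_W W"
  shows "bdd_above ((\<lambda>z. p * z - W z) ` {2..})"
proof -
  from assms obtain D where mono: "strict_mono_on {2..} W" and conv: "convex_on {2..} W"
    and D: "\<And>u. u > 2 \<Longrightarrow> (W has_real_derivative D u) (at_left u)"
    and lim: "filterlim D at_top at_top"
    unfolding admissible_W_def by blast
  have "eventually (\<lambda>u. D u \<ge> p) at_top"
    using lim by (simp add: filterlim_at_top)
  with eventually_gt_at_top[of 2] have "eventually (\<lambda>u. D u \<ge> p \<and> u > 2) at_top"
    by eventually_elim auto
  then obtain u where u: "D u \<ge> p" "u > 2"
    using eventually_happens'[OF trivial_limit_at_top_linorder] by blast
  have slope: "(W z - W u) / (z - u) \<ge> D u" if z: "z > u" for z
  proof (rule tendsto_upperbound)
    show "((\<lambda>v. (W v - W u) / (v - u)) \<longlongrightarrow> D u) (at_left u)"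
      using D[OF u(2)] by (simp add: has_field_derivative_iff)
    show "\<forall>\<^sub>F v in at_left u. (W v - W u) / (v - u) \<le> (W z - W u) / (z - u)"
      using eventually_at_left_real[OF u(2)]
    proof eventually_elim
      case (elim v)
      then show ?case
        using convex_on_slope_le[OF conv, of v z u] z u(2)
        by (smt (verit) atLeast_iff greaterThanLessThan_iff minus_divide_divide)
    qed
  qed simp
  have "p * z - W z \<le> max (p * u - W u) (\<bar>p\<bar> * u - W 2)" if z: "z \<ge> 2" for z
  proof (cases "z > u")
    case True
    have "p * (z - u) \<le> D u * (z - u)"
      using True u(1) by (intro mult_right_mono) auto
    also have "\<dots> \<le> W z - W u"
      using slope[OF True] True by (simp add: field_simps)
    finally show ?thesis by (simp add: algebra_simps)
  next
    case False
    have "W 2 \<le> W z"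
      using z mono by (cases "z = 2") (auto simp: strict_mono_on_def intro: less_imp_le)
    moreover have "p * z \<le> \<bar>p\<bar> * u"
      using False z by (intro mult_mono) auto
    ultimately show ?thesis by linarith
  qed
  then show ?thesis by (intro bdd_aboveI2) auto
qed

definition Psi :: "(real \<Rightarrow> real) set" where
  "Psi = {\<psi>. \<exists>W. admissible_W W \<and> (\<forall>p\<ge>2. \<psi> p = exp (W_conj W p / p))}"

definition Lp_norm :: "'a measure \<Rightarrow> real \<Rightarrow> ('a \<Rightarrow> real) \<Rightarrow> ennreal" where
  "Lp_norm M p \<eta> =
     (let I = (\<integral>\<^sup>+ \<omega>. ennreal (\<bar>\<eta> \<omega>\<bar> powr p) \<partial>M)
      in if I = \<infinity> then \<infinity> else ennreal (enn2real I powr (1 / p)))"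

definition G_norm :: "'a measure \<Rightarrow> (real \<Rightarrow> real) \<Rightarrow> ('a \<Rightarrow> real) \<Rightarrow> ennreal" where
  "G_norm M \<psi> \<eta> = (SUP p\<in>{2..}. Lp_norm M p \<eta> / ennreal (\<psi> p))"

definition R :: "real \<Rightarrow> real \<Rightarrow> (real \<Rightarrow> real) \<Rightarrow> real" where
  "R \<delta> p \<psi> =
     Inf {\<delta> powr (2 / (p * \<beta> + 2)) * \<psi> (\<alpha> * p) powr (p * \<beta> / (p * \<beta> + 2)) | \<alpha> \<beta>.
          \<alpha> > 1 \<and> \<beta> > 1 \<and> 1 / \<alpha> + 1 / \<beta> = 1}"

text \<open>
  Time starts at \<open>0\<close>, with \<open>F 0\<close> trivial; then \<open>S 0 = 0\<close>. A martingale given for \<open>n \<ge> 1\<close> only is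
  covered by setting \<open>S 0 = 0\<close>.
\<close>

definition centered_martingale ::
    "'a measure \<Rightarrow> (nat \<Rightarrow> 'a measure) \<Rightarrow> (nat \<Rightarrow> 'a \<Rightarrow> real) \<Rightarrow> bool" where
  "centered_martingale M F S \<longleftrightarrow>
     filtration (space M) F \<and> (\<forall>n. subalgebra M (F n)) \<and> sets (F 0) = {{}, space M} \<and>
     (\<forall>n. S n \<in> borel_measurable (F n)) \<and>
     (\<forall>n. integrable M (S n)) \<and>
     (\<forall>m n. m \<le> n \<longrightarrow> (AE \<omega> in M. real_cond_exp M (F m) (S n) \<omega> = S m \<omega>)) \<and>
     (\<forall>n. (\<integral>\<omega>. S n \<omega> \<partial>M) = 0)"

end

theory Submission
  imports Defs
begin

text \<open>
  A \<open>G(\<psi>)\<close>-bounded martingale is bounded in \<open>L\<^sup>2\<close>, hence converges almost everywhere (Doob's maximal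
  inequality) and in \<open>L\<^sup>2\<close> (orthogonality of increments) to some \<open>L\<close>, and by Fatou's lemma the
  moment bounds of \<open>S n\<close> pass to \<open>L\<close>. Put \<open>\<xi> = S n - L\<close>, let \<open>D\<close> bound its \<open>L\<^sup>2\<close> norm and \<open>K\<close> its
  norm of order \<open>\<alpha> p\<close>. Splitting \<open>E \<bar>\<xi>\<bar>\<^sup>p\<close> at a level \<open>\<epsilon>\<close> and estimating the part above \<open>\<epsilon>\<close> by
  Hoelder and Chebyshev gives \<open>E \<bar>\<xi>\<bar>\<^sup>p \<le> \<epsilon>\<^sup>p + K\<^sup>p (D / \<epsilon>) powr (2 / \<beta>)\<close>; the level at which both
  terms agree is \<open>\<epsilon> = D powr (2 / (p \<beta> + 2)) * K powr (p \<beta> / (p \<beta> + 2))\<close>, which is the expression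
  minimised in \<open>R\<close>. At this level Young's inequality can replace Hoelder's, which makes the estimate
  pointwise in \<open>\<xi>\<close>.
\<close>

section \<open>Translation between \<open>Lp_norm\<close>, \<open>G_norm\<close> and moment
  bounds\<close>

lemma Lp_norm_leD:
  assumes "Lp_norm M p \<eta> \<le> ennreal B" "p > 0"
  shows "(\<integral>\<^sup>+ x. ennreal (\<bar>\<eta> x\<bar> powr p) \<partial>M) \<le> ennreal (B powr p)"
proof -
  define I where "I = (\<integral>\<^sup>+ x. ennreal (\<bar>\<eta> x\<bar> powr p) \<partial>M)"
  have fin: "I < \<infinity>"
    using assms(1) by (auto simp: Lp_norm_def Let_def I_def[symmetric] less_top[symmetric] top_unique split: if_splits)
  then obtain i where i: "I = ennreal i" "i \<ge> 0"
    by (cases I) auto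
  have *: "ennreal (i powr (1 / p)) \<le> ennreal B"
    using assms(1) fin i by (simp add: Lp_norm_def Let_def I_def[symmetric])
  have "i \<le> B powr p"
  \<comment> \<open>\<open>ennreal\<close> sends negative reals to 0, so \<open>*\<close> yields a
    real inequality only once its left side is known to be positive; for \<open>i = 0\<close> the
    claim is immediate.\<close>
  proof (cases "i = 0")
    case False
    with i have "i powr (1 / p) > 0" by simp
    with * have le: "i powr (1 / p) \<le> B"
      by (metis ennreal_le_iff2 not_less)
    have "i = (i powr (1 / p)) powr p"
      using i assms(2) by (simp add: powr_powr)
    also have "\<dots> \<le> B powr p"
      using le assms(2) by (intro powr_mono2) auto
    finally show ?thesis .
  qed simp
  then show ?thesis
    using i by (simp add: I_def[symmetric] ennreal_leI)
qed

lemma Lp_norm_leI: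
  assumes "(\<integral>\<^sup>+ x. ennreal (\<bar>\<eta> x\<bar> powr p) \<partial>M) \<le> ennreal (B powr p)" "p > 0" "B \<ge> 0"
  shows "Lp_norm M p \<eta> \<le> ennreal B"
proof -
  define I where "I = (\<integral>\<^sup>+ x. ennreal (\<bar>\<eta> x\<bar> powr p) \<partial>M)"
  obtain i where i: "I = ennreal i" "i \<ge> 0"
    using assms(1) by (cases I) (auto simp: I_def[symmetric] top_unique)
  have "i \<le> B powr p"
    using assms(1) i by (simp add: I_def[symmetric])
  then have "i powr (1 / p) \<le> (B powr p) powr (1 / p)"
    using i assms(2) by (intro powr_mono2) auto
  also have "\<dots> = B"
    using assms(2,3) by (simp add: powr_powr)
  finally show ?thesis
    using i by (simp add: Lp_norm_def Let_def I_def[symmetric] ennreal_leI)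
qed

lemma ennreal_le_multI_divide:
  fixes a c :: ennreal
  assumes "a / ennreal b \<le> c" "b > 0"
  shows "a \<le> c * ennreal b"
proof -
  have "a = a / ennreal b * ennreal b"
    using assms(2) by (simp add: ennreal_divide_times ennreal_times_divide[symmetric])
  also have "\<dots> \<le> c * ennreal b"
    using assms(1) by (intro mult_right_mono) auto
  finally show ?thesis .
qed

lemma Lp_norm_le_G_norm:
  assumes "G_norm M \<psi> \<eta> \<le> ennreal C" "p \<ge> 2" "\<psi> p > 0" 
  shows "Lp_norm M p \<eta> \<le> ennreal (C * \<psi> p)"
proof -
  have "Lp_norm M p \<eta> / ennreal (\<psi> p) \<le> ennreal C"
    using assms(1,2) by (auto simp: G_norm_def SUP_le_iff)
  then have "Lp_norm M p \<eta> \<le> ennreal C * ennreal (\<psi> p)"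
    using assms(3) by (rule ennreal_le_multI_divide)
  then show ?thesis using assms(3) by (simp add: ennreal_mult'')
qed

text \<open>Fatou's lemma, with the lower limit identified almost everywhere as \<open>g\<close>. It
  transports moment bounds to the limit; the bound is asked for only eventually because in the
  \<open>L\<^sup>2\<close> estimate it holds from some index on.\<close>

lemma nn_integral_lim_le:
  fixes f :: "nat \<Rightarrow> 'a \<Rightarrow> ennreal"
  assumes "\<And>n. f n \<in> borel_measurable M"
    and "AE x in M. (\<lambda>n. f n x) \<longlonglongrightarrow> g x"
    and "eventually (\<lambda>n. (\<integral>\<^sup>+ x. f n x \<partial>M) \<le> B) sequentially"
  shows "(\<integral>\<^sup>+ x. g x \<partial>M) \<le> B"
proof -
  have "(\<integral>\<^sup>+ x. g x \<partial>M) = (\<integral>\<^sup>+ x. liminf (\<lambda>n. f n x) \<partial>M)"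
    using assms(2) by (intro nn_integral_cong_AE) (auto intro!: lim_imp_Liminf[symmetric])
  also have "\<dots> \<le> liminf (\<lambda>n. \<integral>\<^sup>+ x. f n x \<partial>M)"
    using assms(1) by (rule nn_integral_liminf)
  also have "\<dots> \<le> B"
    using assms(3) by (intro Liminf_le) auto
  finally show ?thesis .
qed

section \<open>Interpolation between the second moment and the moment of order \<alpha> p\<close>

text \<open>The threshold \<open>\<epsilon>\<close> is chosen such that
  \<open>(K / \<epsilon>) powr (p * \<beta>) = (\<epsilon> / D)\<^sup>2\<close>, so that above it the second Young term is a Chebyshev
  bound.\<close>

lemma powr_interpolation:
  fixes x p \<alpha> \<beta> D K \<epsilon> :: real
  assumes p: "p > 0" and ab: "\<alpha> > 1" "\<beta> > 1" "1 / \<alpha> + 1 / \<beta> = 1"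
    and pos: "D > 0" "K > 0" and x: "x \<ge> 0"
  defines "\<epsilon> \<equiv> D powr (2 / (p * \<beta> + 2)) * K powr (p * \<beta> / (p * \<beta> + 2))"
  shows "x powr p \<le> \<epsilon> powr p * (1 + (x powr (\<alpha> * p) / K powr (\<alpha> * p) / \<alpha> + x\<^sup>2 / D\<^sup>2 / \<beta>))"
proof (cases "x \<le> \<epsilon>")
  \<comment> \<open>Below the threshold the summand 1 alone suffices, the Young terms being
    nonnegative.\<close>
  case True
  have "x powr p \<le> \<epsilon> powr p * 1"
    using True x p by (simp add: powr_mono2)
  also have "\<dots> \<le> \<epsilon> powr p * (1 + (x powr (\<alpha> * p) / K powr (\<alpha> * p) / \<alpha> + x\<^sup>2 / D\<^sup>2 / \<beta>))"
    using ab by (intro mult_left_mono) auto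
  finally show ?thesis .
next
  case False
  have e0: "\<epsilon> > 0" using pos by (simp add: \<epsilon>_def)
  then have x0: "x > 0" using False by simp
  have pb: "p * \<beta> + 2 > 0" using p ab by (simp add: add_pos_pos)
  \<comment> \<open>Taking logarithms makes the definition of \<epsilon> a linear equation in
    \<open>ln \<epsilon>\<close>, which is the logarithm of the balance condition.\<close>
  have "ln \<epsilon> = (2 * ln D + p * \<beta> * ln K) / (p * \<beta> + 2)"
    using pos by (simp add: \<epsilon>_def ln_mult ln_powr add_divide_distrib)
  then have "p * \<beta> * ln \<epsilon> + 2 * ln \<epsilon> = 2 * ln D + p * \<beta> * ln K"
    using pb by (simp add: field_simps)
  then have "(K / \<epsilon>) powr (p * \<beta>) = (\<epsilon> / D) powr 2"
    using pos e0 by (simp add: powr_def ln_div algebra_simps)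
  also have "\<dots> \<le> (x / D) powr 2"
    using False e0 pos by (intro powr_mono2 divide_right_mono) auto
  also have "\<dots> = x\<^sup>2 / D\<^sup>2"
    using x0 pos by (simp add: power_divide)
  finally have K: "(K / \<epsilon>) powr (p * \<beta>) \<le> x\<^sup>2 / D\<^sup>2" .
  \<comment> \<open>The ratio \<open>x / \<epsilon>\<close> is factored through \<open>K\<close>, so
    that Young's inequality with exponents \<alpha>, \<beta> produces the moment of order \<alpha> p
    from one factor and the second moment from the other.\<close>
  have "x powr p = \<epsilon> powr p * ((x / K) powr p * (K / \<epsilon>) powr p)"
    using x0 e0 pos by (simp add: powr_divide)
  also have "(x / K) powr p * (K / \<epsilon>) powr p
      \<le> ((x / K) powr p) powr \<alpha> / \<alpha> + ((K / \<epsilon>) powr p) powr \<beta> / \<beta>"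
    using ab by (intro Youngs_inequality) auto
  also have "\<dots> \<le> x powr (\<alpha> * p) / K powr (\<alpha> * p) / \<alpha> + x\<^sup>2 / D\<^sup>2 / \<beta>"
    using K ab x0 pos by (intro add_mono divide_right_mono) (auto simp: powr_powr powr_divide mult.commute)
  also have "\<dots> \<le> 1 + (x powr (\<alpha> * p) / K powr (\<alpha> * p) / \<alpha> + x\<^sup>2 / D\<^sup>2 / \<beta>)"
    by simp
  finally show ?thesis
    by (simp add: mult_left_mono)
qed

text \<open>Integrates the pointwise bound. After normalisation by \<open>K\<close> and
  \<open>D\<close> the two Young terms contribute at most \<open>1 / \<alpha>\<close> and
  \<open>1 / \<beta>\<close>, together 1; with the summand 1, integrated over a probability space,
  this makes the factor 2.\<close>

lemma (in prob_space) nn_integral_powr_interpolation: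
  fixes \<xi> :: "'a \<Rightarrow> real" and p \<alpha> \<beta> D K :: real
  assumes \<xi> [measurable]: "\<xi> \<in> borel_measurable M"
    and p: "p > 0" and ab: "\<alpha> > 1" "\<beta> > 1" "1 / \<alpha> + 1 / \<beta> = 1"
    and pos: "D > 0" "K > 0"
    and D: "(\<integral>\<^sup>+ x. ennreal ((\<xi> x)\<^sup>2) \<partial>M) \<le> ennreal (D\<^sup>2)"
    and K: "(\<integral>\<^sup>+ x. ennreal (\<bar>\<xi> x\<bar> powr (\<alpha> * p)) \<partial>M) \<le> ennreal (K powr (\<alpha> * p))"
  shows "(\<integral>\<^sup>+ x. ennreal (\<bar>\<xi> x\<bar> powr p) \<partial>M)
    \<le> ennreal (2 * (D powr (2 / (p * \<beta> + 2)) * K powr (p * \<beta> / (p * \<beta> + 2))) powr p)"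
proof -
  define c where "c = (D powr (2 / (p * \<beta> + 2)) * K powr (p * \<beta> / (p * \<beta> + 2))) powr p"
  have c: "c \<ge> 0" by (simp add: c_def)
  define k where "k = 1 / K powr (\<alpha> * p) / \<alpha>"
  define d where "d = 1 / D\<^sup>2 / \<beta>"
  have k: "k \<ge> 0" and d: "d \<ge> 0" using ab by (auto simp: k_def d_def)
  have "(\<integral>\<^sup>+ x. ennreal (\<bar>\<xi> x\<bar> powr p) \<partial>M)
      \<le> (\<integral>\<^sup>+ x. ennreal c * (1 + (ennreal k * ennreal (\<bar>\<xi> x\<bar> powr (\<alpha> * p)) + ennreal d * ennreal ((\<xi> x)\<^sup>2))) \<partial>M)"
  proof (rule nn_integral_mono)
    fix x
    have "\<bar>\<xi> x\<bar> powr p \<le> c * (1 + (k * \<bar>\<xi> x\<bar> powr (\<alpha> * p) + d * (\<xi> x)\<^sup>2))"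
      using powr_interpolation[OF p ab pos, of "\<bar>\<xi> x\<bar>"] by (simp add: c_def k_def d_def)
    then have "ennreal (\<bar>\<xi> x\<bar> powr p) \<le> ennreal (c * (1 + (k * \<bar>\<xi> x\<bar> powr (\<alpha> * p) + d * (\<xi> x)\<^sup>2)))"
      by (rule ennreal_leI)
    also have "\<dots> = ennreal c * (1 + (ennreal k * ennreal (\<bar>\<xi> x\<bar> powr (\<alpha> * p)) + ennreal d * ennreal ((\<xi> x)\<^sup>2)))"
      using c k d by (simp add: ennreal_mult ennreal_plus)
    finally show "ennreal (\<bar>\<xi> x\<bar> powr p) \<le> \<dots>" .
  qed
  also have "\<dots> = ennreal c * (1 + (ennreal k * (\<integral>\<^sup>+ x. ennreal (\<bar>\<xi> x\<bar> powr (\<alpha> * p)) \<partial>M)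
      + ennreal d * (\<integral>\<^sup>+ x. ennreal ((\<xi> x)\<^sup>2) \<partial>M)))"
    by (simp add: nn_integral_cmult nn_integral_add emeasure_space_1)
  also have "\<dots> \<le> ennreal c * (1 + (ennreal k * ennreal (K powr (\<alpha> * p)) + ennreal d * ennreal (D\<^sup>2)))"
    by (intro mult_left_mono add_left_mono add_mono D K) auto
  also have "\<dots> = ennreal (c * (1 + (k * K powr (\<alpha> * p) + d * D\<^sup>2)))"
    using c k d by (simp add: ennreal_mult ennreal_plus)
  also have "k * K powr (\<alpha> * p) + d * D\<^sup>2 = 1"
    using ab pos by (simp add: k_def d_def)
  finally show ?thesis by (simp add: c_def mult.commute)
qed

section \<open>Square integrable martingales: orthogonality, maximal inequality, convergence\<close>

lemma integrable_mult_of_squares: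
  fixes f g :: "'a \<Rightarrow> real"
  assumes [measurable]: "f \<in> borel_measurable M" "g \<in> borel_measurable M"
    and "integrable M (\<lambda>x. (f x)\<^sup>2)" "integrable M (\<lambda>x. (g x)\<^sup>2)"
  shows "integrable M (\<lambda>x. f x * g x)"
proof (rule Bochner_Integration.integrable_bound)
  show "integrable M (\<lambda>x. (f x)\<^sup>2 + (g x)\<^sup>2)" using assms(3,4) by simp
  have "\<bar>a * b\<bar> \<le> a\<^sup>2 + b\<^sup>2" for a b :: real
    using sum_squares_bound[of a b] sum_squares_bound[of a "- b"] zero_le_power2[of a] zero_le_power2[of b]
    by simp
  then show "AE x in M. norm (f x * g x) \<le> norm ((f x)\<^sup>2 + (g x)\<^sup>2)"
    by simp
qed simp

locale l2_martingale = prob_space M for M :: "'a measure" +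
  fixes F :: "nat \<Rightarrow> 'a measure" and S :: "nat \<Rightarrow> 'a \<Rightarrow> real"
  assumes filtration: "filtration (space M) F"
    and subalgebra: "\<And>n. subalgebra M (F n)"
    and adapted: "\<And>n. S n \<in> borel_measurable (F n)"
    and martingale: "\<And>m n. m \<le> n \<Longrightarrow> AE x in M. real_cond_exp M (F m) (S n) x = S m x"
    and square_integrable: "\<And>n. integrable M (\<lambda>x. (S n x)\<^sup>2)"
begin

lemma adapted_mono: "m \<le> n \<Longrightarrow> S m \<in> borel_measurable (F n)"
  using adapted[of m] filtration.sets_F_mono[OF filtration, of m n]
  by (auto simp: measurable_def filtration.space_F[OF filtration])

lemma measurable_S [measurable]: "S n \<in> borel_measurable M"
  using measurable_from_subalg[OF subalgebra adapted] .

text \<open>An \<open>F m\<close>-measurable factor can be pulled into the conditional expectation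
  of \<open>S n\<close> given \<open>F m\<close>, which is \<open>S m\<close>. Equivalently, the
  increment \<open>S n - S m\<close> is orthogonal to \<open>f\<close>.\<close>

lemma integral_mult_eq:
  assumes "m \<le> n" and f: "f \<in> borel_measurable (F m)" and int: "integrable M (\<lambda>x. f x * S n x)"
  shows "(\<integral>x. f x * S n x \<partial>M) = (\<integral>x. f x * S m x \<partial>M)"
proof -
  interpret finite_measure_subalgebra M "F m"
    by unfold_locales (rule subalgebra)
  have [measurable]: "f \<in> borel_measurable M"
    using measurable_from_subalg[OF subalgebra f] .
  have "(\<integral>x. f x * S n x \<partial>M) = (\<integral>x. f x * real_cond_exp M (F m) (S n) x \<partial>M)"
    using real_cond_exp_intg(2)[OF int f] by simp
  also have "\<dots> = (\<integral>x. f x * S m x \<partial>M)"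
    using martingale[OF assms(1)] by (intro integral_cong_AE) auto
  finally show ?thesis .
qed

lemma integrable_diff_square: "integrable M (\<lambda>x. (S n x - S m x)\<^sup>2)"
proof -
  have "integrable M (\<lambda>x. (S n x)\<^sup>2 + (S m x)\<^sup>2 - 2 * (S n x * S m x))"
    by (intro Bochner_Integration.integrable_diff Bochner_Integration.integrable_add square_integrable
        integrable_mult_right integrable_mult_of_squares) auto
  then show ?thesis by (simp add: power2_diff mult.assoc)
qed

text \<open>Pythagoras: by orthogonality the mixed term \<open>E (S m * S n)\<close> equals the
  second moment of \<open>S m\<close>.\<close>

lemma expectation_diff_square:
  assumes "m \<le> n"
  shows "expectation (\<lambda>x. (S n x - S m x)\<^sup>2) = expectation (\<lambda>x. (S n x)\<^sup>2) - expectation (\<lambda>x. (S m x)\<^sup>2)"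
proof -
  have int: "integrable M (\<lambda>x. S m x * S n x)"
    by (intro integrable_mult_of_squares square_integrable) auto
  have "expectation (\<lambda>x. S m x * S n x) = expectation (\<lambda>x. S m x * S m x)"
    by (rule integral_mult_eq[OF assms adapted int])
  then have orth: "expectation (\<lambda>x. S m x * S n x) = expectation (\<lambda>x. (S m x)\<^sup>2)"
    by (simp only: power2_eq_square)
  have "expectation (\<lambda>x. (S n x - S m x)\<^sup>2)
      = expectation (\<lambda>x. (S n x)\<^sup>2 + (S m x)\<^sup>2 - 2 * (S m x * S n x))"
    by (intro Bochner_Integration.integral_cong) (simp_all add: power2_diff)
  also have "\<dots> = expectation (\<lambda>x. (S n x)\<^sup>2) + expectation (\<lambda>x. (S m x)\<^sup>2)
      - 2 * expectation (\<lambda>x. S m x * S n x)"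
    by (simp add: int square_integrable)
  finally show ?thesis
    by (simp add: orth)
qed

text \<open>The submartingale property of the squared increments from time \<open>m\<close>. Expand
  the square of \<open>(S k - S m) + (S n - S k)\<close> on \<open>A\<close>: the mixed term
  vanishes, since \<open>indicator A * (S k - S m)\<close> is \<open>F k\<close>-measurable, and the
  square of \<open>S n - S k\<close> is nonnegative.\<close>

lemma set_integral_diff_square_mono:
  assumes "m \<le> k" "k \<le> n" and A: "A \<in> sets (F k)"
  shows "expectation (\<lambda>x. indicator A x * (S k x - S m x)\<^sup>2)
    \<le> expectation (\<lambda>x. indicator A x * (S n x - S m x)\<^sup>2)"
proof -
  have AM [measurable]: "A \<in> sets M"
    using A subalgebra[of k] by (auto simp: subalgebra_def)
  have [measurable]: "S k \<in> borel_measurable (F k)" "S m \<in> borel_measurable (F k)" "A \<in> sets (F k)"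
    using assms adapted_mono by auto
  define f where "f x = indicator A x * (S k x - S m x)" for x
  have f: "f \<in> borel_measurable (F k)"
    unfolding f_def by measurable
  have fM [measurable]: "f \<in> borel_measurable M"
    unfolding f_def by measurable
  have ind: "integrable M (\<lambda>x. indicator A x * g x)" if "integrable M g" for g :: "'a \<Rightarrow> real"
    using integrable_mult_indicator[OF AM that] by simp
  have f2: "integrable M (\<lambda>x. (f x)\<^sup>2)"
    using ind[OF integrable_diff_square[of k m]]
    by (rule Bochner_Integration.integrable_cong[THEN iffD1, rotated -1])
      (auto simp: f_def power_mult_distrib indicator_def)
  have int: "integrable M (\<lambda>x. f x * S j x)" for j
    by (intro integrable_mult_of_squares f2 square_integrable) auto
  have orth: "expectation (\<lambda>x. f x * S n x) = expectation (\<lambda>x. f x * S k x)"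
    using integral_mult_eq[OF assms(2) f int] .
  have "expectation (\<lambda>x. indicator A x * (S n x - S m x)\<^sup>2)
      = expectation (\<lambda>x. indicator A x * (S k x - S m x)\<^sup>2 + indicator A x * (S n x - S k x)\<^sup>2
          + 2 * (f x * S n x - f x * S k x))"
    by (intro Bochner_Integration.integral_cong) (auto simp: f_def indicator_def power2_eq_square algebra_simps)
  also have "\<dots> = expectation (\<lambda>x. indicator A x * (S k x - S m x)\<^sup>2)
      + expectation (\<lambda>x. indicator A x * (S n x - S k x)\<^sup>2)"
    using int ind[OF integrable_diff_square] orth by simp
  finally show ?thesis by simp
qed

text \<open>Kolmogorov's argument: decompose by the first time the deviation reaches \<epsilon>,
  apply Chebyshev at that time, and move from that time to \<open>n\<close> by the submartingale
  property.\<close>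

lemma maximal_inequality:
  assumes "\<epsilon> > 0" "m \<le> n"
  shows "\<epsilon>\<^sup>2 * prob {x \<in> space M. \<exists>k\<in>{m..n}. \<epsilon> \<le> \<bar>S k x - S m x\<bar>}
    \<le> expectation (\<lambda>x. (S n x - S m x)\<^sup>2)"
proof -
  \<comment> \<open>\<open>A k\<close> is the event that \<open>k\<close> is the first time from
    \<open>m\<close> on at which the deviation is at least \<epsilon>. It depends only on the path
    up to \<open>k\<close>, hence lies in \<open>F k\<close>.\<close>
  define A where "A k = {x \<in> space M. \<epsilon> \<le> \<bar>S k x - S m x\<bar> \<and> (\<forall>j\<in>{m..<k}. \<bar>S j x - S m x\<bar> < \<epsilon>)}" for k
  have A: "A k \<in> sets (F k)" if "m \<le> k" for k
  proof -
    have "{x \<in> space (F k). \<epsilon> \<le> \<bar>S k x - S m x\<bar>} \<in> sets (F k)"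
    proof -
      have [measurable]: "S k \<in> borel_measurable (F k)" "S m \<in> borel_measurable (F k)"
        using adapted_mono that by auto
      show ?thesis by measurable
    qed
    moreover have "{x \<in> space (F k). \<bar>S j x - S m x\<bar> < \<epsilon>} \<in> sets (F k)" if "j \<in> {m..<k}" for j
    proof -
      have [measurable]: "S j \<in> borel_measurable (F k)" "S m \<in> borel_measurable (F k)"
        using adapted_mono that by auto
      show ?thesis by measurable
    qed
    moreover have "A k = {x \<in> space (F k). \<epsilon> \<le> \<bar>S k x - S m x\<bar>} \<inter>
        {x \<in> space (F k). \<forall>j\<in>{m..<k}. \<bar>S j x - S m x\<bar> < \<epsilon>}"
      by (auto simp: A_def filtration.space_F[OF filtration])
    ultimately show ?thesis
      by (simp add: sets.Int sets.sets_Collect_finite_All)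
  qed
  have AM [measurable]: "A k \<in> sets M" for k
    unfolding A_def by measurable
  have disj: "disjoint_family_on A {m..n}"
    unfolding disjoint_family_on_def A_def
    by (auto simp: not_less) (metis atLeastLessThan_iff linorder_neqE_nat not_le)
  have Un: "{x \<in> space M. \<exists>k\<in>{m..n}. \<epsilon> \<le> \<bar>S k x - S m x\<bar>} = (\<Union>k\<in>{m..n}. A k)"
  \<comment> \<open>The least index in the set of deviation times selects the event
    \<open>A k\<close> that contains \<open>x\<close>.\<close>
  proof (intro equalityI subsetI)
    fix x assume x: "x \<in> {x \<in> space M. \<exists>k\<in>{m..n}. \<epsilon> \<le> \<bar>S k x - S m x\<bar>}"
    define P where "P k \<longleftrightarrow> m \<le> k \<and> \<epsilon> \<le> \<bar>S k x - S m x\<bar>" for k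
    obtain k where "P k" "k \<le> n" using x by (auto simp: P_def)
    then have "P (LEAST k. P k)" "(LEAST k. P k) \<le> n"
      by (auto intro: LeastI order_trans[OF Least_le])
    moreover have "\<bar>S j x - S m x\<bar> < \<epsilon>" if "j \<in> {m..<(LEAST k. P k)}" for j
      using that not_less_Least[of j P] by (auto simp: P_def)
    ultimately have "x \<in> A (LEAST k. P k)" "(LEAST k. P k) \<in> {m..n}"
      using x unfolding A_def by (auto simp del: atLeastLessThan_iff simp: P_def[of "LEAST k. P k"])
    then show "x \<in> (\<Union>k\<in>{m..n}. A k)" by blast
  qed (auto simp: A_def)
  have ind: "integrable M (\<lambda>x. indicator (A k) x * (S j x - S m x)\<^sup>2)" for k j
    using integrable_mult_indicator[OF AM integrable_diff_square] by simp
  have "\<epsilon>\<^sup>2 * prob (\<Union>k\<in>{m..n}. A k) = (\<Sum>k\<in>{m..n}. \<epsilon>\<^sup>2 * prob (A k))"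
    using disj by (subst finite_measure_finite_Union) (auto simp: sum_distrib_left)
  also have "\<dots> \<le> (\<Sum>k\<in>{m..n}. expectation (\<lambda>x. indicator (A k) x * (S n x - S m x)\<^sup>2))"
  proof (rule sum_mono)
    fix k assume k: "k \<in> {m..n}"
    have "\<epsilon>\<^sup>2 * prob (A k) = expectation (\<lambda>x. indicator (A k) x * \<epsilon>\<^sup>2)"
      by simp
    also have "\<dots> \<le> expectation (\<lambda>x. indicator (A k) x * (S k x - S m x)\<^sup>2)"
    proof (rule integral_mono)
      show "indicator (A k) x * \<epsilon>\<^sup>2 \<le> indicator (A k) x * (S k x - S m x)\<^sup>2" for x
        using assms(1) power_mono[of \<epsilon> "\<bar>S k x - S m x\<bar>" 2] by (auto simp: A_def indicator_def)
    qed (use ind AM in \<open>auto simp: integrable_indicator_iff less_top[symmetric]\<close>)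
    also have "\<dots> \<le> expectation (\<lambda>x. indicator (A k) x * (S n x - S m x)\<^sup>2)"
      using k A by (intro set_integral_diff_square_mono) auto
    finally show "\<epsilon>\<^sup>2 * prob (A k) \<le> expectation (\<lambda>x. indicator (A k) x * (S n x - S m x)\<^sup>2)" .
  qed
  also have "\<dots> = expectation (\<lambda>x. indicator (\<Union>k\<in>{m..n}. A k) x * (S n x - S m x)\<^sup>2)"
    unfolding indicator_UN_disjoint[OF finite_atLeastAtMost disj] sum_distrib_right
    by (intro Bochner_Integration.integral_sum[symmetric] ind)
  also have "\<dots> \<le> expectation (\<lambda>x. (S n x - S m x)\<^sup>2)"
  proof (rule integral_mono)
    show "integrable M (\<lambda>x. indicator (\<Union>k\<in>{m..n}. A k) x * (S n x - S m x)\<^sup>2)"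
      using integrable_mult_indicator[OF _ integrable_diff_square, of "\<Union>k\<in>{m..n}. A k"] by simp
  qed (auto simp: indicator_def integrable_diff_square)
  finally show ?thesis by (simp add: Un)
qed

text \<open>Continuity from below along the increasing events \<open>E n\<close> removes the upper
  time limit.\<close>

lemma maximal_inequality_tail:
  assumes "\<epsilon> > 0" and B: "\<And>n. m \<le> n \<Longrightarrow> expectation (\<lambda>x. (S n x - S m x)\<^sup>2) \<le> B"
  shows "prob {x \<in> space M. \<exists>k\<ge>m. \<epsilon> \<le> \<bar>S k x - S m x\<bar>} \<le> B / \<epsilon>\<^sup>2"
proof -
  define E where "E n = {x \<in> space M. \<exists>k\<in>{m..n}. \<epsilon> \<le> \<bar>S k x - S m x\<bar>}" for n
  have "(\<lambda>n. prob (E n)) \<longlonglongrightarrow> prob (\<Union>n. E n)"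
  proof (rule finite_Lim_measure_incseq)
    show "range E \<subseteq> sets M" unfolding E_def by auto
    show "incseq E" by (rule incseq_SucI) (fastforce simp: E_def)
  qed
  moreover have "prob (E n) \<le> B / \<epsilon>\<^sup>2" if "n \<ge> m" for n
    using maximal_inequality[OF assms(1) that] B[OF that] assms(1) by (simp add: E_def field_simps)
  ultimately have "prob (\<Union>n. E n) \<le> B / \<epsilon>\<^sup>2"
    by (intro LIMSEQ_le_const2) auto
  also have "(\<Union>n. E n) = {x \<in> space M. \<exists>k\<ge>m. \<epsilon> \<le> \<bar>S k x - S m x\<bar>}"
    unfolding E_def by (auto; meson atLeastAtMost_iff order_refl)
  finally show ?thesis .
qed

theorem l2_bounded_convergence:
  assumes bdd: "\<And>n. expectation (\<lambda>x. (S n x)\<^sup>2) \<le> C"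
  obtains L r where "L \<in> borel_measurable M" "AE x in M. (\<lambda>n. S n x) \<longlonglongrightarrow> L x"
    "r \<longlonglongrightarrow> 0" "\<And>n. r n \<ge> 0"
    "\<And>n. (\<integral>\<^sup>+ x. ennreal ((S n x - L x)\<^sup>2) \<partial>M) \<le> ennreal (r n)"
proof -
  define V where "V n = expectation (\<lambda>x. (S n x)\<^sup>2)" for n
  have V: "expectation (\<lambda>x. (S n x - S m x)\<^sup>2) = V n - V m" if "m \<le> n" for m n
    using expectation_diff_square[OF that] by (simp add: V_def)
  have "incseq V"
  proof (rule monoI)
    fix m n :: nat assume "m \<le> n"
    have "expectation (\<lambda>x. (S n x - S m x)\<^sup>2) \<ge> 0" by simp
    with V[OF \<open>m \<le> n\<close>] show "V m \<le> V n" by simp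
  qed
  then obtain s where s: "V \<longlonglongrightarrow> s" "\<And>n. V n \<le> s"
    using incseq_convergent[of V C] bdd by (auto simp: V_def)
  \<comment> \<open>The second moments \<open>V n\<close> increase to \<open>s\<close>, so
    \<open>r m\<close> dominates the squared \<open>L\<^sup>2\<close> distance of \<open>S m\<close>
    to every later \<open>S n\<close>.\<close>
  define r where "r n = s - V n" for n
  have r0: "r \<longlonglongrightarrow> 0"
    unfolding r_def using tendsto_diff[OF tendsto_const s(1), of s] by simp
  have r: "expectation (\<lambda>x. (S n x - S m x)\<^sup>2) \<le> r m" if "m \<le> n" for m n
    using V[OF that] s(2)[of n] by (simp add: r_def)
  have small: "AE x in M. \<exists>m. \<forall>k\<ge>m. \<bar>S k x - S m x\<bar> < \<epsilon>" if \<epsilon>: "\<epsilon> > 0" for \<epsilon>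
  proof -
    define N where "N = {x \<in> space M. \<forall>m. \<exists>k\<ge>m. \<epsilon> \<le> \<bar>S k x - S m x\<bar>}"
    have N [measurable]: "N \<in> sets M" unfolding N_def by measurable
    \<comment> \<open>The set \<open>N\<close> is independent of \<open>m\<close> and lies in each
      tail event, so its probability is below every \<open>r m / \<epsilon>\<^sup>2\<close>.\<close>
    have "prob N \<le> r m / \<epsilon>\<^sup>2" for m
    proof -
      have "prob N \<le> prob {x \<in> space M. \<exists>k\<ge>m. \<epsilon> \<le> \<bar>S k x - S m x\<bar>}"
        by (rule finite_measure_mono) (auto simp: N_def)
      also have "\<dots> \<le> r m / \<epsilon>\<^sup>2"
        using r by (intro maximal_inequality_tail \<epsilon>)
      finally show ?thesis .
    qed
    moreover have "(\<lambda>m. r m / \<epsilon>\<^sup>2) \<longlonglongrightarrow> 0"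
      using tendsto_divide[OF r0 tendsto_const, of "\<epsilon>\<^sup>2"] \<epsilon> by simp
    ultimately have "prob N \<le> 0"
      by (intro LIMSEQ_le_const) auto
    then have "AE x in M. x \<notin> N"
      using prob_eq_0[OF N] measure_nonneg[of M N] by linarith
    then show ?thesis
      using AE_space
    proof eventually_elim
      case (elim x)
      then obtain m where "\<not> (\<exists>k\<ge>m. \<epsilon> \<le> \<bar>S k x - S m x\<bar>)"
        by (auto simp: N_def)
      then show ?case by (meson not_le)
    qed
  qed
  \<comment> \<open>Restricting \<epsilon> to the countably many values
    \<open>inverse (Suc j)\<close> allows the exceptional null sets to be united.\<close>
  have "AE x in M. \<forall>j. \<exists>m. \<forall>k\<ge>m. \<bar>S k x - S m x\<bar> < inverse (Suc j)"
    unfolding AE_all_countable by (intro allI small) simp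
  then have conv: "AE x in M. convergent (\<lambda>n. S n x)"
  proof eventually_elim
    case (elim x)
    have "Cauchy (\<lambda>n. S n x)"
      \<comment> \<open>This form of the Cauchy property compares all late terms with one fixed
        term, which is exactly what \<open>small\<close> controls.\<close>
      unfolding Cauchy_altdef2
    proof (intro allI impI)
      fix e :: real assume "e > 0"
      then obtain j where j: "inverse (Suc j) < e" using reals_Archimedean by blast
      from elim obtain m where "\<forall>k\<ge>m. \<bar>S k x - S m x\<bar> < inverse (Suc j)" by blast
      with j show "\<exists>N. \<forall>n\<ge>N. dist (S n x) (S N x) < e"
        by (force simp: dist_real_def intro!: exI[of _ m])
    qed
    then show ?case by (simp add: Cauchy_convergent_iff)
  qed
  define L where "L x = lim (\<lambda>n. S n x)" for x
  have L [measurable]: "L \<in> borel_measurable M"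
    unfolding L_def by measurable
  have lim: "AE x in M. (\<lambda>n. S n x) \<longlonglongrightarrow> L x"
    using conv by eventually_elim (simp add: L_def convergent_LIMSEQ_iff)
  have "(\<integral>\<^sup>+ x. ennreal ((S n x - L x)\<^sup>2) \<partial>M) \<le> ennreal (r n)" for n
  \<comment> \<open>Fatou in \<open>k\<close> with \<open>n\<close> fixed; the bound
    \<open>r n\<close> is available for \<open>k \<ge> n\<close>.\<close>
  proof (rule nn_integral_lim_le)
    show "AE x in M. (\<lambda>k. ennreal ((S n x - S k x)\<^sup>2)) \<longlonglongrightarrow> ennreal ((S n x - L x)\<^sup>2)"
      using lim by eventually_elim (auto intro!: tendsto_intros)
    have "(\<integral>\<^sup>+ x. ennreal ((S n x - S k x)\<^sup>2) \<partial>M) \<le> ennreal (r n)" if "k \<ge> n" for k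
      using r[OF that] integrable_diff_square
      by (simp add: nn_integral_eq_integral power2_commute[of "S n _"] ennreal_leI)
    then show "\<forall>\<^sub>F k in sequentially. (\<integral>\<^sup>+ x. ennreal ((S n x - S k x)\<^sup>2) \<partial>M) \<le> ennreal (r n)"
      using eventually_ge_at_top by (rule eventually_mono[rotated])
  qed simp
  with L lim r0 s(2) show ?thesis by (intro that) (auto simp: r_def)
qed

end

section \<open>Moments of a difference, and the comparison with \<open>R\<close>\<close>

text \<open>A crude substitute for Minkowski's inequality: one factor 2 comes from
  \<open>\<bar>a - b\<bar> \<le> 2 * max \<bar>a\<bar> \<bar>b\<bar>\<close>, the other from adding
  two moments and using \<open>2 \<le> 2 powr q\<close>. What matters is that the constant 4 does
  not depend on \<open>q\<close>.\<close>

lemma nn_integral_powr_diff_le: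
  fixes f g :: "'a \<Rightarrow> real"
  assumes [measurable]: "f \<in> borel_measurable M" "g \<in> borel_measurable M"
    and B: "B \<ge> 0" and q: "q \<ge> 1"
    and f: "(\<integral>\<^sup>+ x. ennreal (\<bar>f x\<bar> powr q) \<partial>M) \<le> ennreal (B powr q)"
    and g: "(\<integral>\<^sup>+ x. ennreal (\<bar>g x\<bar> powr q) \<partial>M) \<le> ennreal (B powr q)"
  shows "(\<integral>\<^sup>+ x. ennreal (\<bar>f x - g x\<bar> powr q) \<partial>M) \<le> ennreal ((4 * B) powr q)"
proof -
  have pw: "\<bar>a - b\<bar> powr q \<le> 2 powr q * (\<bar>a\<bar> powr q + \<bar>b\<bar> powr q)" for a b :: real
  proof -
    have "\<bar>a - b\<bar> powr q \<le> (2 * max \<bar>a\<bar> \<bar>b\<bar>) powr q"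
      using q by (intro powr_mono2) auto
    also have "\<dots> = 2 powr q * max \<bar>a\<bar> \<bar>b\<bar> powr q" by (rule powr_mult)
    also have "\<dots> \<le> 2 powr q * (\<bar>a\<bar> powr q + \<bar>b\<bar> powr q)"
      by (intro mult_left_mono) (auto simp: max_def)
    finally show ?thesis .
  qed
  have "(\<integral>\<^sup>+ x. ennreal (\<bar>f x - g x\<bar> powr q) \<partial>M)
      \<le> (\<integral>\<^sup>+ x. ennreal (2 powr q) * (ennreal (\<bar>f x\<bar> powr q) + ennreal (\<bar>g x\<bar> powr q)) \<partial>M)"
    using ennreal_leI[OF pw] by (intro nn_integral_mono) (simp add: ennreal_mult ennreal_plus)
  also have "\<dots> = ennreal (2 powr q) * ((\<integral>\<^sup>+ x. ennreal (\<bar>f x\<bar> powr q) \<partial>M) + (\<integral>\<^sup>+ x. ennreal (\<bar>g x\<bar> powr q) \<partial>M))"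
    by (simp add: nn_integral_cmult nn_integral_add)
  also have "\<dots> \<le> ennreal (2 powr q) * (ennreal (B powr q) + ennreal (B powr q))"
    by (intro mult_left_mono add_mono f g) auto
  also have "\<dots> = ennreal (2 powr q * (2 * B powr q))"
    by (simp add: ennreal_mult ennreal_plus flip: mult_2)
  also have "\<dots> \<le> ennreal (2 powr q * (2 powr q * B powr q))"
    using q powr_mono[of 1 q 2] by (intro ennreal_leI mult_left_mono mult_right_mono) auto
  also have "2 powr q * (2 powr q * B powr q) = (4 * B) powr q"
    using B powr_mult[of 2 2 q] by (simp add: powr_mult)
  finally show ?thesis .
qed

text \<open>Interpolation with \<open>D = \<delta>\<close> and
  \<open>K = c * \<psi> (\<alpha> * p)\<close> bounds the norm by \<open>2 * c\<close> times each
  element of the set in \<open>R\<close>; the infimum follows because \<open>2 * c\<close> is the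
  same for all \<alpha>, \<beta>.\<close>

lemma (in prob_space) Lp_norm_le_R:
  fixes \<xi> :: "'a \<Rightarrow> real"
  assumes \<xi>: "\<xi> \<in> borel_measurable M" and p: "p \<ge> 2" and \<delta>: "\<delta> > 0" and c: "c \<ge> 1"
    and \<psi>: "\<And>q. q \<ge> 2 \<Longrightarrow> \<psi> q > 0"
    and L2: "(\<integral>\<^sup>+ x. ennreal ((\<xi> x)\<^sup>2) \<partial>M) \<le> ennreal (\<delta>\<^sup>2)"
    and Lq: "\<And>q. q \<ge> 2 \<Longrightarrow> (\<integral>\<^sup>+ x. ennreal (\<bar>\<xi> x\<bar> powr q) \<partial>M) \<le> ennreal ((c * \<psi> q) powr q)"
  shows "Lp_norm M p \<xi> \<le> ennreal (2 * c * R \<delta> p \<psi>)"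
proof -
  let ?T = "{\<delta> powr (2 / (p * \<beta> + 2)) * \<psi> (\<alpha> * p) powr (p * \<beta> / (p * \<beta> + 2)) | \<alpha> \<beta>.
          \<alpha> > 1 \<and> \<beta> > 1 \<and> 1 / \<alpha> + 1 / \<beta> = (1::real)}"
  have bound: "Lp_norm M p \<xi> \<le> ennreal (2 * c * t)" if "t \<in> ?T" for t
  proof -
    from that obtain \<alpha> \<beta> :: real where ab: "\<alpha> > 1" "\<beta> > 1" "1 / \<alpha> + 1 / \<beta> = 1"
      and t: "t = \<delta> powr (2 / (p * \<beta> + 2)) * \<psi> (\<alpha> * p) powr (p * \<beta> / (p * \<beta> + 2))"
      by blast
    have ap: "\<alpha> * p \<ge> 2"
      using mult_mono[of 1 \<alpha> 2 p] ab p by simp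
    define \<theta> where "\<theta> = p * \<beta> / (p * \<beta> + 2)"
    have pb: "p * \<beta> > 0" using p ab by simp
    have \<theta>: "0 \<le> \<theta>" "\<theta> \<le> 1" using pb by (auto simp: \<theta>_def)
    have "(\<integral>\<^sup>+ x. ennreal (\<bar>\<xi> x\<bar> powr p) \<partial>M)
      \<le> ennreal (2 * (\<delta> powr (2 / (p * \<beta> + 2)) * (c * \<psi> (\<alpha> * p)) powr \<theta>) powr p)"
      unfolding \<theta>_def using p c \<psi>[OF ap] ab \<delta> L2 Lq[OF ap]
      by (intro nn_integral_powr_interpolation \<xi>) auto
    also have "\<dots> \<le> ennreal ((2 * c * t) powr p)"
    proof (rule ennreal_leI)
      \<comment> \<open>Since \<open>c \<ge> 1\<close> and \<open>\<theta> \<le> 1\<close>, the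
        constant leaves the power as at most \<open>c\<close>, whatever \<beta> is.\<close>
      have "c powr \<theta> \<le> c powr 1"
        using c \<theta> by (intro powr_mono) auto
      then have "\<delta> powr (2 / (p * \<beta> + 2)) * (c * \<psi> (\<alpha> * p)) powr \<theta> \<le> c * t"
        using c \<psi>[OF ap] mult_right_mono[of "c powr \<theta>" c t]
        unfolding t \<theta>_def[symmetric] by (simp add: powr_mult mult.left_commute)
      then have "(\<delta> powr (2 / (p * \<beta> + 2)) * (c * \<psi> (\<alpha> * p)) powr \<theta>) powr p \<le> (c * t) powr p"
        using p by (intro powr_mono2) auto
      moreover have "2 \<le> 2 powr p"
        using p powr_mono[of 1 p 2] by simp
      ultimately have "2 * (\<delta> powr (2 / (p * \<beta> + 2)) * (c * \<psi> (\<alpha> * p)) powr \<theta>) powr p \<le> 2 powr p * (c * t) powr p"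
        by (intro mult_mono) auto
      then show "2 * (\<delta> powr (2 / (p * \<beta> + 2)) * (c * \<psi> (\<alpha> * p)) powr \<theta>) powr p \<le> (2 * c * t) powr p"
        by (simp add: powr_mult mult.assoc)
    qed
    finally show ?thesis
      using p c by (intro Lp_norm_leI) (auto simp: t)
  qed
  \<comment> \<open>The conjugate pair \<alpha> = \<beta> = 2 shows that the infimum is over a
    nonempty set. One element also makes the norm finite, so the infimum can be handled in the
    reals.\<close>
  have ne: "?T \<noteq> {}"
    by (rule ex_in_conv[THEN iffD1], rule exI, rule CollectI, rule exI[of _ 2], rule exI[of _ 2]) auto
  then obtain t0 where "t0 \<in> ?T" by blast
  from bound[OF this] have "Lp_norm M p \<xi> \<noteq> \<top>"
    by (auto simp: top_unique)
  then obtain l where l: "Lp_norm M p \<xi> = ennreal l" "l \<ge> 0"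
    by (cases "Lp_norm M p \<xi>") auto
  have "l / (2 * c) \<le> Inf ?T"
  proof (rule cInf_greatest[OF ne])
    fix t assume t: "t \<in> ?T"
    then have "t \<ge> 0" by auto
    with bound[OF t] l c have "l \<le> 2 * c * t" by simp
    then show "l / (2 * c) \<le> t" using c by (simp add: field_simps)
  qed
  then show ?thesis
    using l c by (simp add: R_def field_simps ennreal_leI)
qed

section \<open>Convergence in the norm of G(\<nu>)\<close>

lemma Psi_pos: "\<psi> \<in> Psi \<Longrightarrow> p \<ge> 2 \<Longrightarrow> \<psi> p > 0"
  by (auto simp: Psi_def)

theorem theorem9:
  fixes \<psi> \<nu> :: "real \<Rightarrow> real"
    and M :: "'a measure"
    and F :: "nat \<Rightarrow> 'a measure"
    and S :: "nat \<Rightarrow> 'a \<Rightarrow> real"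
  assumes "\<psi> \<in> Psi" and "\<nu> \<in> Psi"
    and "((\<lambda>\<delta>. SUP p\<in>{2..}. ennreal (R \<delta> p \<psi> / \<nu> p)) \<longlongrightarrow> 0) (at_right 0)"
    and "prob_space M"
    and "centered_martingale M F S"
    and "(SUP n. G_norm M \<psi> (S n)) < \<infinity>"
  shows "\<exists>L \<in> borel_measurable M.
           (AE \<omega> in M. (\<lambda>n. S n \<omega>) \<longlonglongrightarrow> L \<omega>) \<and>
           (\<lambda>n. G_norm M \<nu> (\<lambda>\<omega>. S n \<omega> - L \<omega>)) \<longlonglongrightarrow> 0"
proof -
  interpret prob_space M by fact
  note \<psi> = Psi_pos[OF assms(1)] and \<nu> = Psi_pos[OF assms(2)]
  have SM [measurable]: "S n \<in> borel_measurable M" for n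
    using assms(5) unfolding centered_martingale_def by (blast intro: measurable_from_subalg)
  obtain C0 where C0: "(SUP n. G_norm M \<psi> (S n)) = ennreal C0" "C0 \<ge> 0"
    using assms(6) by (cases "SUP n. G_norm M \<psi> (S n)") auto
  \<comment> \<open>The maximum with 1 secures the condition \<open>c \<ge> 1\<close> of
    \<open>Lp_norm_le_R\<close>, applied below with \<open>c = 4 * C\<close>.\<close>
  define C where "C = max 1 C0"
  have C: "C \<ge> 1" by (simp add: C_def)
  have G: "G_norm M \<psi> (S n) \<le> ennreal C" for n
  proof -
    have "G_norm M \<psi> (S n) \<le> ennreal C0" unfolding C0(1)[symmetric] by (rule SUP_upper) simp
    also have "\<dots> \<le> ennreal C" by (intro ennreal_leI) (simp add: C_def)
    finally show ?thesis .
  qed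
  have moments: "(\<integral>\<^sup>+ x. ennreal (\<bar>S n x\<bar> powr q) \<partial>M) \<le> ennreal ((C * \<psi> q) powr q)" if "q \<ge> 2" for n q
    using Lp_norm_le_G_norm[OF G that \<psi>[OF that]] that by (intro Lp_norm_leD) auto
  have sq: "(\<integral>\<^sup>+ x. ennreal ((S n x)\<^sup>2) \<partial>M) \<le> ennreal ((C * \<psi> 2)\<^sup>2)" for n
    using moments[of 2 n] \<psi>[of 2] C by simp
  have sqint: "integrable M (\<lambda>x. (S n x)\<^sup>2)" for n
    using sq[of n] by (intro integrableI_bounded) (auto simp: le_less_trans)
  have sqle: "expectation (\<lambda>x. (S n x)\<^sup>2) \<le> (C * \<psi> 2)\<^sup>2" for n
    using sq[of n] sqint[of n] by (simp add: nn_integral_eq_integral)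
  have "l2_martingale_axioms M F S"
    using assms(5) sqint unfolding centered_martingale_def l2_martingale_axioms_def by blast
  then interpret l2_martingale M F S
    by (intro l2_martingale.intro prob_space_axioms)
  obtain L r where L [measurable]: "L \<in> borel_measurable M"
    and lim: "AE x in M. (\<lambda>n. S n x) \<longlonglongrightarrow> L x"
    and r: "r \<longlonglongrightarrow> 0" "\<And>n. r n \<ge> 0"
    and L2: "\<And>n. (\<integral>\<^sup>+ x. ennreal ((S n x - L x)\<^sup>2) \<partial>M) \<le> ennreal (r n)"
    using l2_bounded_convergence[OF sqle] by blast
  have moments_L: "(\<integral>\<^sup>+ x. ennreal (\<bar>L x\<bar> powr q) \<partial>M) \<le> ennreal ((C * \<psi> q) powr q)" if "q \<ge> 2" for q
  proof (rule nn_integral_lim_le)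
    show "AE x in M. (\<lambda>n. ennreal (\<bar>S n x\<bar> powr q)) \<longlonglongrightarrow> ennreal (\<bar>L x\<bar> powr q)"
      using lim by eventually_elim (use that in \<open>auto intro!: tendsto_intros tendsto_powr'\<close>)
  qed (use moments[OF that] in auto)
  have moments_diff: "(\<integral>\<^sup>+ x. ennreal (\<bar>S n x - L x\<bar> powr q) \<partial>M) \<le> ennreal ((4 * C * \<psi> q) powr q)"
    if "q \<ge> 2" for n q
    using nn_integral_powr_diff_le[OF SM L _ _ moments[OF that] moments_L[OF that]] that \<psi>[OF that] C
    by (simp add: mult.assoc)
  \<comment> \<open>The summand \<open>inverse (Suc n)\<close> keeps \<open>\<delta> n\<close> positive when \<open>r n = 0\<close>.\<close>
  define \<delta> where "\<delta> n = sqrt (r n) + inverse (Suc n)" for n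
  have \<delta>: "\<delta> n > 0" for n
    using r(2)[of n] by (simp add: \<delta>_def add_nonneg_pos)
  have "\<delta> \<longlonglongrightarrow> sqrt 0 + 0"
    unfolding \<delta>_def by (intro tendsto_add tendsto_real_sqrt r(1) LIMSEQ_inverse_real_of_nat)
  moreover have "\<delta> n \<noteq> 0" for n
    using \<delta>[of n] by simp
  ultimately have \<delta>0: "filterlim \<delta> (at_right 0) sequentially"
    using \<delta> by (auto simp: filterlim_at)
  have L2': "(\<integral>\<^sup>+ x. ennreal ((S n x - L x)\<^sup>2) \<partial>M) \<le> ennreal ((\<delta> n)\<^sup>2)" for n
  proof -
    have "r n = (sqrt (r n))\<^sup>2" using r(2) by simp
    also have "\<dots> \<le> (\<delta> n)\<^sup>2" using r(2)[of n] by (intro power_mono) (auto simp: \<delta>_def)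
    finally show ?thesis using L2[of n] by (meson ennreal_leI order_trans)
  qed
  \<comment> \<open>\<open>Q\<close> takes the supremum over \<open>p\<close> before \<delta> tends
    to 0; as the factor \<open>8 * C\<close> is free of \<open>p\<close> and \<open>n\<close>,
    \<open>Q (\<delta> n)\<close> controls the whole norm.\<close>
  define Q where "Q d = (SUP p\<in>{2..}. ennreal (R d p \<psi> / \<nu> p))" for d
  have upper: "G_norm M \<nu> (\<lambda>x. S n x - L x) \<le> ennreal (8 * C) * Q (\<delta> n)" for n
    unfolding G_norm_def
  proof (rule SUP_least)
    fix p :: real assume "p \<in> {2..}"
    then have p: "p \<ge> 2" by simp
    have "Lp_norm M p (\<lambda>x. S n x - L x) \<le> ennreal (2 * (4 * C) * R (\<delta> n) p \<psi>)"
    proof (rule Lp_norm_le_R)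
      show "(\<lambda>x. S n x - L x) \<in> borel_measurable M" by measurable
    qed (fact p \<delta> \<psi> L2' moments_diff | use C in simp)+
    then have "Lp_norm M p (\<lambda>x. S n x - L x) / ennreal (\<nu> p)
        \<le> ennreal (8 * C * R (\<delta> n) p \<psi>) / ennreal (\<nu> p)"
      by (intro divide_right_mono_ennreal) simp
    also have "\<dots> = ennreal (8 * C) * ennreal (R (\<delta> n) p \<psi> / \<nu> p)"
    \<comment> \<open>For negative \<open>R\<close> both sides would be 0, as \<open>ennreal\<close>
      truncates, so the identity holds whatever the sign.\<close>
    proof (cases "R (\<delta> n) p \<psi> \<ge> 0")
      case True
      then show ?thesis using \<nu>[OF p] C by (simp add: divide_ennreal flip: ennreal_mult)
    next
      case False
      then show ?thesis using \<nu>[OF p] C by (simp add: ennreal_neg mult_nonneg_nonpos divide_nonpos_pos)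
    qed
    also have "\<dots> \<le> ennreal (8 * C) * Q (\<delta> n)"
      unfolding Q_def using p by (intro mult_left_mono SUP_upper) auto
    finally show "Lp_norm M p (\<lambda>x. S n x - L x) / ennreal (\<nu> p) \<le> ennreal (8 * C) * Q (\<delta> n)" .
  qed
  have "(Q \<longlongrightarrow> 0) (at_right 0)"
    using assms(3) unfolding Q_def[abs_def] .
  then have "(\<lambda>n. Q (\<delta> n)) \<longlonglongrightarrow> 0"
    using \<delta>0 by (rule filterlim_compose)
  then have "(\<lambda>n. ennreal (8 * C) * Q (\<delta> n)) \<longlonglongrightarrow> ennreal (8 * C) * 0"
    by (intro ennreal_tendsto_cmult) simp_all
  then have lim0: "(\<lambda>n. ennreal (8 * C) * Q (\<delta> n)) \<longlonglongrightarrow> 0"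
    by simp
  have "(\<lambda>n. G_norm M \<nu> (\<lambda>x. S n x - L x)) \<longlonglongrightarrow> 0"
    by (rule tendsto_sandwich[OF _ _ tendsto_const lim0]) (simp_all add: upper)
  with L lim show ?thesis by blast
qed

end
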